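(* Let $a\ge 2$ be an integer. Let $q$ and $z$ be complex numbers with $0<|q|<1$ and $z\neq 0$. Then $$\sum_{\substack{\vec n=(n_0,n_1,\dots,n_{a-1})\in\mathbb{Z}^a\\ \vec n\cdot\vec 1_a=0}} q^{\frac a2\,\vec n\cdot\vec n+\vec b_a\cdot\vec n}\sum_{j=0}^{a-1}z^{an_j+j} \;=\; E(q)\,E(q^a)^{a-2}\prod_{n=1}^\infty\frac{(1-z^aq^{a(n-1)})(1-z^{-a}q^{an})}{(1-zq^{n-1})(1-z^{-1}q^n)}.$$
   Context: $E(q):=\prod_{n=1}^\infty(1-q^n)$. $\vec 1_a=(1,1,\dots,1)\in\mathbb{Z}^a$, $\vec b_a=(0,1,2,\dots,a-1)\in\mathbb{Z}^a$, and $\cdot$ is the standard dot product. On the right-hand side, at those $z$ (integer powers of $q$) where a denominator factor vanishes, the corresponding numerator factor vanishes as well, and the quotient is understood by cancelling (removable singularities), so that the right side is analytic for all $z\ne0$. *)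

theory Defs
  imports "HOL-Complex_Analysis.Complex_Analysis"
begin

definition euler_E :: "complex \<Rightarrow> complex" where
  "euler_E q = (\<Prod>n. 1 - q ^ Suc n)"

(* Vectors in Z^a are the functions on {..<a} that are undefined elsewhere. *)
definition zero_sum_vecs :: "nat \<Rightarrow> (nat \<Rightarrow> int) set" where
  "zero_sum_vecs a = {n \<in> {..<a} \<rightarrow>\<^sub>E UNIV. (\<Sum>j<a. n j) = 0}"

(* (a/2) n.n + b_a.n as an integer; the division by 2 is exact on zero_sum_vecs,
   see q_exponent_exact. *)
definition q_exponent :: "nat \<Rightarrow> (nat \<Rightarrow> int) \<Rightarrow> int" where
  "q_exponent a n = (int a * (\<Sum>j<a. n j * n j)) div 2 + (\<Sum>j<a. int j * n j)"

lemma q_exponent_exact: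
  assumes "n \<in> zero_sum_vecs a"
  shows "of_int (q_exponent a n)
    = real a / 2 * (\<Sum>j<a. of_int (n j * n j)) + (\<Sum>j<a. real j * of_int (n j))"
proof -
  have "even ((\<Sum>j<a. n j * n j) - (\<Sum>j<a. n j))"
    unfolding sum_subtractf[symmetric] by (rule dvd_sum) auto
  then have "even (\<Sum>j<a. n j * n j)"
    using assms by (simp add: zero_sum_vecs_def)
  then obtain k where k: "(\<Sum>j<a. n j * n j) = 2 * k" by blast
  have "real_of_int (\<Sum>j<a. n j * n j) = 2 * of_int k"
    unfolding k by simp
  then have "(\<Sum>j<a. real_of_int (n j * n j)) = 2 * of_int k"
    by simp
  then show ?thesis
    by (simp add: q_exponent_def k)
qed

(* The factor of index n + 1 of the product, before cancelling; in HOL it takes the value 0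
   where its denominator vanishes. *)
definition quot_factor :: "nat \<Rightarrow> complex \<Rightarrow> nat \<Rightarrow> complex \<Rightarrow> complex" where
  "quot_factor a q n z =
     ((1 - z ^ a * q ^ (a * n)) * (1 - z powi (- int a) * q ^ (a * (n + 1))))
     / ((1 - z * q ^ n) * (1 - inverse z * q ^ (n + 1)))"

end

theory Submission imports Defs "HOL-Real_Asymp.Real_Asymp" begin

text \<open>
  Write \<open>F\<close> for the left-hand side, \<open>E\<close> for \<open>euler_E\<close> and \<open>theta q z\<close> for the sum of
  \<open>(- z) ^ m * q ^ (m * (m - 1) / 2)\<close> over all integers \<open>m\<close>, which by the Jacobi triple product
  is \<open>E(q)\<close> times the denominator on the right. A bijection that rotates the vectors shows that the
  coefficients of \<open>F(z) * theta q z\<close> satisfy \<open>l (k + a) = - q ^ k * l k\<close>. Hence \<open>F(z) * theta q z\<close>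
  is the sum of \<open>l r * z ^ r * theta (q ^ a) (z ^ a * q ^ r)\<close> over \<open>r < a\<close>. It vanishes at every
  \<open>a\<close>-th root of unity: at \<open>1\<close> because \<open>theta q\<close> does, at the others because \<open>F\<close> does termwise.
  So \<open>l r * theta (q ^ a) (q ^ r) = 0\<close> for all \<open>r\<close>, and since \<open>theta (q ^ a) (q ^ r)\<close> is nonzero for
  \<open>0 < r < a\<close>, only \<open>r = 0\<close> survives: \<open>F\<close> is a constant times the product on the right, first
  where the denominator is nonzero and then everywhere by continuity. The constant is
  found at \<open>z = 1\<close>: the product of the \<open>theta (q ^ a) (x * q ^ j)\<close> over \<open>j < a\<close> is a multiple of
  \<open>theta q x\<close>, and its constant term in \<open>x\<close> gives \<open>F(1) = a * E(q ^ a) ^ a / E(q)\<close>.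
\<close>

section \<open>Products of values of a polynomial along a geometric progression\<close>

text \<open>One notion for two kinds of product: \<open>[:1, -1:]\<close> gives the
  \<open>q\<close>-Pochhammer symbol and \<open>geom_poly\<close> gives the cancelled factors on the
  right, so convergence, continuity and zeros are treated once.\<close>

definition poly_qprod :: "complex poly \<Rightarrow> complex \<Rightarrow> complex \<Rightarrow> complex" where
  "poly_qprod p q x = (\<Prod>n. poly p (x * q ^ n))"

lemma poly_minus_1_bound:
  fixes p :: "complex poly"
  assumes "poly p 0 = 1"
  obtains C where "C \<ge> 0" "\<And>w. norm w \<le> R \<Longrightarrow> norm (poly p w - 1) \<le> C * norm w"
proof -
  obtain c r where p: "p = pCons c r" by (cases p)
  with assms have c: "c = 1" by simp
  have "bounded (poly r ` cball 0 R)"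
    by (intro compact_imp_bounded compact_continuous_image continuous_intros) auto
  then obtain C where C: "C > 0" "\<And>w. w \<in> cball 0 R \<Longrightarrow> norm (poly r w) \<le> C"
    by (auto simp: bounded_pos)
  have "norm (poly p w - 1) \<le> C * norm w" if "norm w \<le> R" for w
    using C(2)[of w] that by (simp add: p c norm_mult mult.commute[of C] mult_left_mono)
  with C(1) that show thesis by (meson less_imp_le)
qed

context
  fixes q :: complex
  assumes q: "norm q < 1"
begin

text \<open>As \<open>p - 1\<close> vanishes at 0, it is at most a constant times its argument on a
  disc, which yields a geometric majorant uniform in \<open>x\<close>.\<close>

lemma poly_qprod_bound:
  assumes "poly p 0 = 1"
  obtains M where "summable M" "\<And>x n. norm x \<le> R \<Longrightarrow> norm (poly p (x * q ^ n) - 1) \<le> M n"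
proof -
  obtain C where C: "C \<ge> 0" "\<And>w. norm w \<le> R \<Longrightarrow> norm (poly p w - 1) \<le> C * norm w"
    by (rule poly_minus_1_bound[OF assms, of R]) blast
  have "norm (poly p (x * q ^ n) - 1) \<le> C * R * norm q ^ n" if "norm x \<le> R" for x n
  proof -
    have le: "norm (x * q ^ n) \<le> R * norm q ^ n"
      using that by (simp add: norm_mult norm_power mult_right_mono)
    have "0 \<le> R" using that norm_ge_zero order_trans by blast
    then have "R * norm q ^ n \<le> R * 1"
      using q by (intro mult_left_mono) (auto simp: power_le_one)
    then have "norm (poly p (x * q ^ n) - 1) \<le> C * norm (x * q ^ n)"
      using le by (intro C) auto
    also have "\<dots> \<le> C * (R * norm q ^ n)"
      using le C(1) by (intro mult_left_mono)
    finally show ?thesis by (simp add: mult.assoc)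
  qed
  moreover have "summable (\<lambda>n. C * R * norm q ^ n)"
    using q by (intro summable_mult summable_geometric) auto
  ultimately show thesis using that by blast
qed

lemma convergent_poly_qprod:
  assumes "poly p 0 = 1"
  shows "convergent_prod (\<lambda>n. poly p (x * q ^ n))"
proof -
  obtain M where M: "summable M"
    "\<And>y n. norm y \<le> norm x \<Longrightarrow> norm (poly p (y * q ^ n) - 1) \<le> M n"
    by (rule poly_qprod_bound[OF assms, of "norm x"]) blast
  have "summable (\<lambda>n. norm (poly p (x * q ^ n) - 1))"
    using M by (intro summable_comparison_test[OF _ M(1)]) auto
  then show ?thesis
    by (intro abs_convergent_prod_imp_convergent_prod summable_imp_abs_convergent_prod)
qed

lemma poly_qprod_LIMSEQ:
  assumes "poly p 0 = 1"
  shows "(\<lambda>N. \<Prod>n<N. poly p (x * q ^ n)) \<longlonglongrightarrow> poly_qprod p q x"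
  using convergent_prod_LIMSEQ[OF convergent_poly_qprod[OF assms, of x]]
  unfolding poly_qprod_def by (simp add: LIMSEQ_lessThan_iff_atMost)

text \<open>The partial products converge uniformly on a closed disc with \<open>x\<close> in its
  interior, by the M-test with the majorant of \<open>poly_qprod_bound\<close>.\<close>

lemma isCont_poly_qprod:
  assumes "poly p 0 = 1"
  shows "isCont (poly_qprod p q) x"
proof -
  define R where "R = norm x + 1"
  obtain M where M: "summable M"
    "\<And>y n. norm y \<le> R \<Longrightarrow> norm (poly p (y * q ^ n) - 1) \<le> M n"
    by (rule poly_qprod_bound[OF assms, of R]) blast
  have "uniformly_convergent_on (cball 0 R) (\<lambda>N y. \<Sum>n<N. norm (poly p (y * q ^ n) - 1))"
    using M by (intro Weierstrass_m_test'[OF _ M(1)]) auto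
  then have "uniformly_convergent_on (cball 0 R) (\<lambda>N y. \<Prod>n<N. poly p (y * q ^ n))"
    by (intro uniformly_convergent_on_prod') (auto intro!: continuous_intros)
  then obtain l where l: "uniform_limit (cball 0 R) (\<lambda>N y. \<Prod>n<N. poly p (y * q ^ n)) l sequentially"
    by (auto simp: uniformly_convergent_on_def)
  have "continuous_on (cball 0 R) l"
    by (rule uniform_limit_theorem[OF _ l]) (auto intro!: continuous_intros always_eventually)
  moreover have "l y = poly_qprod p q y" if "y \<in> cball 0 R" for y
    using tendsto_uniform_limitI[OF l that] poly_qprod_LIMSEQ[OF assms] LIMSEQ_unique by blast
  ultimately have "continuous_on (cball 0 R) (poly_qprod p q)"
    by (subst continuous_on_cong[OF refl, of _ _ l]) auto
  moreover have "x \<in> interior (cball 0 R)"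
    by (simp add: R_def)
  ultimately show ?thesis
    by (rule continuous_on_interior)
qed

lemma poly_qprod_mult:
  assumes "poly p 0 = 1" "poly r 0 = 1"
  shows "poly_qprod (p * r) q x = poly_qprod p q x * poly_qprod r q x"
  unfolding poly_qprod_def poly_mult
  by (intro prodinf_mult[symmetric] convergent_poly_qprod assms)

lemma poly_qprod_eq_0_iff:
  assumes "poly p 0 = 1"
  shows "poly_qprod p q x = 0 \<longleftrightarrow> (\<exists>n. poly p (x * q ^ n) = 0)"
  unfolding poly_qprod_def
  using has_prod_eq_0_iff[OF convergent_prod_has_prod[OF convergent_poly_qprod[OF assms, of x]]]
  by auto

end

section \<open>The \<open>q\<close>-Pochhammer symbol and Euler's product\<close>

abbreviation qpoch :: "complex \<Rightarrow> complex \<Rightarrow> complex" where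
  "qpoch q x \<equiv> poly_qprod [:1, -1:] q x"

lemma euler_E_eq_qpoch: "euler_E q = qpoch q q"
  by (simp add: euler_E_def poly_qprod_def)

lemma qpoch_eq_0_iff:
  assumes "norm q < 1"
  shows "qpoch q x = 0 \<longleftrightarrow> (\<exists>n. x * q ^ n = 1)"
  using poly_qprod_eq_0_iff[OF assms, of "[:1, -1:]" x] by auto

lemma euler_E_nonzero:
  assumes "norm q < 1"
  shows "euler_E q \<noteq> 0"
proof -
  have "norm (q * q ^ n) < 1" for n
    using assms power_less_one_iff[of "norm q" "Suc n"]
    by (metis norm_ge_zero norm_power power_Suc zero_less_Suc)
  then show ?thesis
    unfolding euler_E_eq_qpoch qpoch_eq_0_iff[OF assms]
    by (metis less_irrefl norm_one)
qed

lemma qpoch_LIMSEQ: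
  assumes "norm q < 1"
  shows "(\<lambda>N. \<Prod>n<N. 1 - x * q ^ n) \<longlonglongrightarrow> qpoch q x"
  using poly_qprod_LIMSEQ[OF assms, of "[:1, -1:]" x] by simp

text \<open>Each index is \<open>n * a + j\<close> for exactly one \<open>j < a\<close>. The
  regrouping is done in the first \<open>N * a\<close> factors, so that only finite products are
  rearranged before \<open>N\<close> tends to infinity.\<close>

lemma qpoch_regroup:
  assumes q: "norm q < 1" and a: "a > 0"
  shows "(\<Prod>j<a. qpoch (q ^ a) (x * q ^ j)) = qpoch q x"
proof -
  have qa: "norm (q ^ a) < 1"
    using q a by (simp add: norm_power power_less_one_iff)
  have "(\<lambda>N. \<Prod>j<a. \<Prod>n<N. 1 - (x * q ^ j) * (q ^ a) ^ n)
          \<longlonglongrightarrow> (\<Prod>j<a. qpoch (q ^ a) (x * q ^ j))"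
    by (intro tendsto_prod qpoch_LIMSEQ[OF qa])
  moreover have "(\<Prod>j<a. \<Prod>n<N. 1 - (x * q ^ j) * (q ^ a) ^ n) = (\<Prod>n<N * a. 1 - x * q ^ n)" for N
  proof -
    have "(\<Prod>n<N * a. 1 - x * q ^ n) = (\<Prod>n<N. \<Prod>k\<in>{n * a..<n * a + a}. 1 - x * q ^ k)"
      by (rule prod.nat_group[symmetric])
    also have "\<dots> = (\<Prod>n<N. \<Prod>j<a. 1 - (x * q ^ j) * (q ^ a) ^ n)"
    proof (rule prod.cong[OF refl])
      fix n
      show "(\<Prod>k\<in>{n * a..<n * a + a}. 1 - x * q ^ k) = (\<Prod>j<a. 1 - (x * q ^ j) * (q ^ a) ^ n)"
        by (rule prod.reindex_bij_witness[of _ "\<lambda>j. n * a + j" "\<lambda>k. k - n * a"])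
           (auto simp: mult_ac simp flip: power_mult power_add)
    qed
    finally show ?thesis by (simp add: prod.swap[of _ "{..<a}"])
  qed
  moreover have "(\<lambda>N. \<Prod>n<N * a. 1 - x * q ^ n) \<longlonglongrightarrow> qpoch q x"
    using LIMSEQ_subseq_LIMSEQ[OF qpoch_LIMSEQ[OF q, of x], of "\<lambda>N. N * a"] a
    by (simp add: strict_mono_def o_def)
  ultimately show ?thesis
    using LIMSEQ_unique by simp
qed

section \<open>The Jacobi triple product\<close>

definition tri :: "int \<Rightarrow> int" where
  "tri m = m * (m - 1) div 2"

lemma two_tri: "2 * tri m = m * (m - 1)"
  by (simp add: tri_def)

lemma tri_plus_1: "tri (m + 1) = tri m + m"
  using two_tri[of m] two_tri[of "m + 1"] by (simp add: algebra_simps)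

lemma tri_minus_1: "tri (m - 1) = tri m - m + 1"
  using tri_plus_1[of "m - 1"] by simp

lemma tri_0 [simp]: "tri 0 = 0"
  by (simp add: tri_def)

definition theta :: "complex \<Rightarrow> complex \<Rightarrow> complex" where
  "theta q x = (\<Sum>\<^sub>\<infinity>m. (- x) powi m * q powi tri m)"

text \<open>The ratio \<open>b * r ^ n\<close> of consecutive terms tends to 0. Both halves of a
  theta series have this shape.\<close>

lemma summable_geometric_ratio:
  fixes c :: "nat \<Rightarrow> real"
  assumes "\<And>n. c n \<ge> 0" "\<And>n. c (Suc n) = c n * (b * r ^ n)" "0 \<le> r" "r < 1"
  shows "summable c"
proof -
  have "(\<lambda>n. b * r ^ n) \<longlonglongrightarrow> b * 0"
    using assms by (intro tendsto_intros LIMSEQ_power_zero) auto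
  then have "\<forall>\<^sub>F n in sequentially. b * r ^ n < 1 / 2"
    by (rule order_tendstoD(2)) simp
  then obtain N where N: "\<And>n. n \<ge> N \<Longrightarrow> b * r ^ n < 1 / 2"
    by (auto simp: eventually_sequentially)
  show ?thesis
  proof (rule summable_ratio_test[of "1 / 2" N])
    fix n assume "n \<ge> N"
    then have "c n * (b * r ^ n) \<le> c n * (1 / 2)"
      using N[of n] assms(1)[of n] by (intro mult_left_mono) auto
    then show "norm (c (Suc n)) \<le> 1 / 2 * norm (c n)"
      using assms(1)[of n] assms(1)[of "Suc n"] assms(2)[of n] by (simp add: mult.commute)
  qed simp
qed

lemma summable_on_int:
  fixes g :: "int \<Rightarrow> real"
  assumes "(\<lambda>n. g (int n)) summable_on UNIV" "(\<lambda>n. g (- int n)) summable_on UNIV"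
  shows "g summable_on UNIV"
proof -
  have "g summable_on range int" "g summable_on range (\<lambda>n. - int n)"
    using assms by (subst summable_on_reindex; auto simp: inj_on_def o_def)+
  then have "g summable_on (range int \<union> range (\<lambda>n. - int n))"
    by (rule summable_on_union)
  moreover have "(range int \<union> range (\<lambda>n. - int n)) = UNIV"
    by (auto simp: image_iff) (metis int_cases2)
  ultimately show ?thesis by simp
qed

lemma theta_abs_summable:
  assumes q: "0 < norm (q :: complex)" "norm q < 1" and x: "x \<noteq> 0"
  shows "(\<lambda>m. norm (x powi m * q powi tri m)) summable_on (UNIV :: int set)"
proof (rule summable_on_int; rule summable_nonneg_imp_summable_on)
  let ?c = "\<lambda>m. norm (x powi m * q powi tri m)"
  have [simp]: "q \<noteq> 0" using q by auto
  have "?c (int (Suc n)) = ?c (int n) * (norm x * norm q ^ n)" for n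
    using x tri_plus_1[of "int n"]
    by (simp add: add.commute[of 1] power_int_add norm_mult norm_power mult_ac norm_power_int)
  then show "summable (\<lambda>n. ?c (int n))"
    by (rule summable_geometric_ratio[rotated]) (use q in auto)
  have "?c (- int (Suc n)) = ?c (- int n) * ((norm q / norm x) * norm q ^ n)" for n
  proof -
    have "x powi (- int (Suc n)) = x powi (- int n) / x"
      using x power_int_diff[of x "- int n" 1] by (simp add: minus_diff_commute)
    moreover have "q powi tri (- int (Suc n)) = q powi tri (- int n) * (q * q ^ n)"
    proof -
      have "tri (- int (Suc n)) = tri (- int n) + int (Suc n)"
        using tri_minus_1[of "- int n"] by (simp add: minus_diff_commute)
      then show ?thesis
        by (simp only: power_int_add[OF disjI1[OF \<open>q \<noteq> 0\<close>]] power_int_of_nat power_Suc)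
    qed
    ultimately show ?thesis
      by (simp only: norm_mult norm_divide norm_power) (simp add: mult_ac)
  qed
  then show "summable (\<lambda>n. ?c (- int n))"
    by (rule summable_geometric_ratio[rotated]) (use q in auto)
qed auto

lemma theta_has_sum:
  assumes q: "0 < norm q" "norm q < 1" and x: "x \<noteq> 0"
  shows "((\<lambda>m. (- x) powi m * q powi tri m) has_sum theta q x) UNIV"
  unfolding theta_def
  by (rule has_sum_infsum[OF abs_summable_summable[OF theta_abs_summable]]) (use q x in auto)

section \<open>Gaussian binomials and the finite triple product\<close>

definition qfac :: "complex \<Rightarrow> nat \<Rightarrow> complex" where
  "qfac q n = (\<Prod>k<n. 1 - q * q ^ k)"

lemma qfac_0 [simp]: "qfac q 0 = 1"
  by (simp add: qfac_def)

lemma qfac_Suc: "qfac q (Suc n) = qfac q n * (1 - q ^ Suc n)"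
  by (simp add: qfac_def)

lemma qfac_LIMSEQ: "norm q < 1 \<Longrightarrow> qfac q \<longlonglongrightarrow> euler_E q"
  unfolding qfac_def euler_E_eq_qpoch by (rule qpoch_LIMSEQ)

lemma qfac_nonzero:
  assumes "norm q < 1"
  shows "qfac q n \<noteq> 0"
proof -
  have "norm (q ^ Suc k) < 1" for k
    using assms power_less_one_iff[of "norm q" "Suc k"]
    by (metis norm_ge_zero norm_power zero_less_Suc)
  then have "1 - q * q ^ k \<noteq> 0" for k
    by (metis eq_iff_diff_eq_0 less_irrefl norm_one power_Suc)
  then show ?thesis by (simp add: qfac_def)
qed

text \<open>Gaussian binomials by a Pascal rule, free of division. The truncated difference
  \<open>n - k\<close> for \<open>n < k\<close> does no harm, since \<open>qbinomial q n k\<close>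
  is 0 there.\<close>

fun qbinomial :: "complex \<Rightarrow> nat \<Rightarrow> nat \<Rightarrow> complex" where
  "qbinomial q n 0 = 1"
| "qbinomial q 0 (Suc k) = 0"
| "qbinomial q (Suc n) (Suc k) = qbinomial q n (Suc k) + q ^ (n - k) * qbinomial q n k"

lemma qbinomial_eq_0: "n < k \<Longrightarrow> qbinomial q n k = 0"
  by (induction q n k rule: qbinomial.induct) auto

lemma qbinomial_self: "qbinomial q n n = 1"
  by (induction n) (auto simp: qbinomial_eq_0)

text \<open>The usual quotient of \<open>q\<close>-factorials with denominators cleared. Pascal's
  rule reduces it to \<open>(1 - q ^ l) + q ^ l * (1 - q ^ k) = 1 - q ^ (k + l)\<close>.\<close>

lemma qbinomial_qfac: "qbinomial q (k + l) k * (qfac q k * qfac q l) = qfac q (k + l)"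
proof (induction "k + l" arbitrary: k l)
  case (Suc n)
  show ?case
  proof (cases k)
    case (Suc k')
    show ?thesis
    proof (cases l)
      case 0
      then show ?thesis
        by (simp add: qbinomial_self)
    next
      fix l' assume l: "l = Suc l'"
      have 1: "qbinomial q (k' + l) k' * (qfac q k' * qfac q l) = qfac q n"
        using Suc.hyps(1)[of k' l] Suc.hyps(2) Suc by simp
      have 2: "qbinomial q (k + l') k * (qfac q k * qfac q l') = qfac q n"
        using Suc.hyps(1)[of k l'] Suc.hyps(2) l by simp
      have n: "n = k' + l" "n = k + l'"
        using Suc.hyps(2) Suc l by auto
      have "qbinomial q (k + l) k * (qfac q k * qfac q l)
          = (1 - q ^ l) * (qbinomial q (k + l') k * (qfac q k * qfac q l'))
            + q ^ l * (1 - q ^ k) * (qbinomial q (k' + l) k' * (qfac q k' * qfac q l))"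
        using Suc l by (simp add: qfac_Suc algebra_simps)
      also have "\<dots> = qfac q n * (1 - q ^ (k + l))"
        unfolding 1 2 by (simp add: algebra_simps power_add)
      also have "\<dots> = qfac q (k + l)"
        using qfac_Suc[of q n] Suc.hyps(2) by simp
      finally show ?thesis .
    qed
  qed simp
qed simp

text \<open>By induction on \<open>M\<close>: the part \<open>- y * q ^ M\<close> of the new factor
  turns \<open>t k\<close> into \<open>q ^ (M - k) * t (Suc k)\<close>, which is the shift that the
  Pascal rule for \<open>qbinomial\<close> encodes.\<close>

lemma qbinomial_theorem:
  assumes [simp]: "q \<noteq> 0"
  shows "(\<Prod>n<M. 1 - y * q ^ n) = (\<Sum>k\<le>M. qbinomial q M k * ((- y) ^ k * q powi tri (int k)))"
proof (induction M)
  case (Suc M)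
  define t where "t k = (- y) ^ k * q powi tri (int k)" for k
  have t: "- y * q ^ M * t k = q ^ (M - k) * t (Suc k)" if "k \<le> M" for k
  proof -
    have "q ^ M = q ^ (M - k) * q ^ k"
      using that by (simp flip: power_add)
    then show ?thesis
      using tri_plus_1[of "int k"] by (simp add: t_def power_int_add add.commute[of 1])
  qed
  have "(\<Sum>k\<le>Suc M. qbinomial q (Suc M) k * t k)
      = t 0 + (\<Sum>k\<le>M. qbinomial q M (Suc k) * t (Suc k))
        + (\<Sum>k\<le>M. q ^ (M - k) * qbinomial q M k * t (Suc k))"
    by (simp only: sum.atMost_Suc_shift) (simp add: algebra_simps sum.distrib)
  also have "t 0 + (\<Sum>k\<le>M. qbinomial q M (Suc k) * t (Suc k)) = (\<Sum>k\<le>Suc M. qbinomial q M k * t k)"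
    by (simp only: sum.atMost_Suc_shift) simp
  also have "\<dots> = (\<Sum>k\<le>M. qbinomial q M k * t k)"
    by (simp add: qbinomial_eq_0)
  also have "(\<Sum>k\<le>M. q ^ (M - k) * qbinomial q M k * t (Suc k))
      = (\<Sum>k\<le>M. - y * q ^ M * (qbinomial q M k * t k))"
  proof (intro sum.cong refl)
    fix k assume "k \<in> {..M}"
    then show "q ^ (M - k) * qbinomial q M k * t (Suc k) = - y * q ^ M * (qbinomial q M k * t k)"
      using t[of k] by (metis atMost_iff mult.assoc mult.commute)
  qed
  also have "\<dots> = - y * q ^ M * (\<Sum>k\<le>M. qbinomial q M k * t k)"
    by (simp only: sum_distrib_left)
  finally show ?case
    using Suc.IH unfolding t_def[symmetric] by (simp add: algebra_simps)
qed simp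

text \<open>Shifting \<open>x\<close> by \<open>q ^ N\<close> turns the \<open>q\<close>-binomial theorem for an even upper index into a
  truncation of the triple product.\<close>

lemma finite_triple_product:
  assumes q [simp]: "q \<noteq> 0" and x [simp]: "x \<noteq> 0"
  shows "(\<Prod>n<N. 1 - x * q ^ n) * (\<Prod>n<N. 1 - q / x * q ^ n)
    = (\<Sum>m\<in>{- int N..int N}. qbinomial q (2 * N) (nat (int N + m)) * ((- x) powi m * q powi tri m))"
proof -
  define y where "y = x / q ^ N"
  \<comment> \<open>The first \<open>N\<close> factors, in reverse order, are
    \<open>1 - x / q ^ Suc n\<close>. Taking out \<open>- x / q ^ Suc n\<close> leaves
    \<open>1 - q / x * q ^ n\<close>; \<open>D\<close> is the product of what is taken out.\<close>
  define D where "D = (- x) ^ N * q powi (- tri (int N + 1))"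
  have D: "(\<Prod>n<N. - x / q ^ Suc n) = D"
    unfolding D_def
  proof (induction N)
    case (Suc N)
    have "- tri (int (Suc N) + 1) = - tri (int N + 1) - int (Suc N)"
      using tri_plus_1[of "int N + 1"] by simp
    then have "q powi (- tri (int (Suc N) + 1)) = q powi (- tri (int N + 1)) / q ^ Suc N"
      by (simp only: power_int_diff[OF disjI1[OF q]] power_int_of_nat)
    then show ?case
      unfolding prod.lessThan_Suc Suc.IH by simp
  qed (simp add: tri_def)
  have "(\<Prod>n<N. 1 - y * q ^ n) = (\<Prod>n<N. 1 - y * q ^ (N - Suc n))"
    by (rule prod.nat_diff_reindex[symmetric])
  also have "\<dots> = (\<Prod>n<N. (- x / q ^ Suc n) * (1 - q / x * q ^ n))"
  proof (rule prod.cong[OF refl])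
    fix n assume "n \<in> {..<N}"
    then have "q ^ N = q ^ (N - Suc n) * q ^ Suc n"
      by (simp flip: power_add power_Suc)
    then have "y * q ^ (N - Suc n) = x / q ^ Suc n"
      by (simp add: y_def)
    then show "1 - y * q ^ (N - Suc n) = (- x / q ^ Suc n) * (1 - q / x * q ^ n)"
      by (simp add: field_simps)
  qed
  also have "\<dots> = D * (\<Prod>n<N. 1 - q / x * q ^ n)"
    by (simp only: prod.distrib D)
  finally have 1: "(\<Prod>n<N. 1 - y * q ^ n) = D * (\<Prod>n<N. 1 - q / x * q ^ n)" .
  have "(\<Prod>n<2 * N. 1 - y * q ^ n) = (\<Prod>n<N. 1 - y * q ^ n) * (\<Prod>n\<in>{N..<2 * N}. 1 - y * q ^ n)"
    by (subst prod.union_disjoint[symmetric]) (auto intro!: prod.cong)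
  also have "(\<Prod>n\<in>{N..<2 * N}. 1 - y * q ^ n) = (\<Prod>n<N. 1 - x * q ^ n)"
    by (rule prod.reindex_bij_witness[of _ "\<lambda>n. n + N" "\<lambda>n. n - N"])
       (auto simp: y_def power_diff)
  finally have 2: "(\<Prod>n<2 * N. 1 - y * q ^ n)
      = (\<Prod>n<N. 1 - y * q ^ n) * (\<Prod>n<N. 1 - x * q ^ n)" .
  have "D * ((\<Prod>n<N. 1 - x * q ^ n) * (\<Prod>n<N. 1 - q / x * q ^ n)) = (\<Prod>n<2 * N. 1 - y * q ^ n)"
    unfolding 2 1 by (simp only: mult_ac)
  also have "\<dots> = (\<Sum>k\<le>2 * N. qbinomial q (2 * N) k * ((- y) ^ k * q powi tri (int k)))"
    by (rule qbinomial_theorem[OF q])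
  also have "\<dots> = (\<Sum>m\<in>{- int N..int N}.
      D * (qbinomial q (2 * N) (nat (int N + m)) * ((- x) powi m * q powi tri m)))"
  proof (rule sum.reindex_bij_witness[of _ "\<lambda>m. nat (int N + m)" "\<lambda>k. int k - int N"])
    fix k assume "k \<in> {..2 * N}"
    have "(- y) ^ k = (- x) ^ k * q powi (- (int N * int k))"
    proof -
      have "(- y) ^ k = (- x) ^ k / (q ^ N) ^ k"
        unfolding y_def minus_divide_left by (rule power_divide)
      also have "(q ^ N) ^ k = q powi (int N * int k)"
        by (metis of_nat_mult power_int_of_nat power_mult)
      finally show ?thesis
        by (simp add: power_int_minus divide_inverse)
    qed
    moreover have "(- x) ^ k = (- x) ^ N * (- x) powi (int k - int N)"
      by (simp add: power_int_diff)
    moreover have "- (int N * int k) + tri (int k) = - tri (int N + 1) + tri (int k - int N)"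
      using two_tri[of "int k"] two_tri[of "int N + 1"] two_tri[of "int k - int N"]
      by (simp add: algebra_simps)
    then have "q powi (- (int N * int k)) * q powi tri (int k)
        = q powi (- tri (int N + 1)) * q powi tri (int k - int N)"
      by (simp flip: power_int_add)
    ultimately have "(- y) ^ k * q powi tri (int k)
        = D * ((- x) powi (int k - int N) * q powi tri (int k - int N))"
      by (simp add: D_def mult_ac)
    then show "D * (qbinomial q (2 * N) (nat (int N + (int k - int N)))
          * ((- x) powi (int k - int N) * q powi tri (int k - int N)))
        = qbinomial q (2 * N) k * ((- y) ^ k * q powi tri (int k))"
      by (simp add: mult_ac)
  qed auto
  finally show ?thesis
    by (simp add: D_def flip: sum_distrib_left)
qed

text \<open>The limit of \<open>finite_triple_product\<close>: each coefficient tends to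
  \<open>inverse (euler_E q)\<close> and all of them share one bound, so dominated convergence
  carries the limit into the sum.\<close>

lemma jacobi_triple_product:
  assumes q: "0 < norm q" "norm q < 1" and x: "x \<noteq> 0"
  shows "theta q x = euler_E q * (qpoch q x * qpoch q (q / x))"
proof -
  define E where "E = euler_E q"
  \<comment> \<open>Coefficients set to 0 outside the range make every truncation a sum over all
    integers.\<close>
  define b where "b N m = (if m \<in> {- int N..int N} then qbinomial q (2 * N) (nat (int N + m)) else 0)"
    for N m
  define t where "t m = (- x) powi m * q powi tri m" for m
  have E: "E \<noteq> 0"
    unfolding E_def by (rule euler_E_nonzero) fact
  have qfac_nz: "qfac q n \<noteq> 0" for n
    by (rule qfac_nonzero) fact
  have b_eq: "b N m = qfac q (2 * N) * inverse (qfac q (nat (int N + m))) * inverse (qfac q (nat (int N - m)))"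
    if "m \<in> {- int N..int N}" for N m
  proof -
    have "nat (int N + m) + nat (int N - m) = 2 * N"
      using that by auto
    with qbinomial_qfac[of q "nat (int N + m)" "nat (int N - m)"] that qfac_nz show ?thesis
      by (simp add: b_def field_simps)
  qed
  have lim: "qfac q \<longlonglongrightarrow> E" "(\<lambda>n. inverse (qfac q n)) \<longlonglongrightarrow> inverse E"
    using qfac_LIMSEQ[OF q(2)] E by (auto simp: E_def intro!: tendsto_inverse)
  obtain B B' where B: "\<And>n. norm (qfac q n) \<le> B" "\<And>n. norm (inverse (qfac q n)) \<le> B'" "B > 0" "B' > 0"
    using convergent_imp_Bseq[OF convergentI[OF lim(1)]] convergent_imp_Bseq[OF convergentI[OF lim(2)]]
    unfolding Bseq_def by blast
  have b_bound: "norm (b N m) \<le> B * B' * B'" for N m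
  proof (cases "m \<in> {- int N..int N}")
    case True
    show ?thesis
      unfolding b_eq[OF True] norm_mult using B by (intro mult_mono mult_nonneg_nonneg norm_ge_zero) auto
  qed (use B in \<open>auto simp: b_def\<close>)
  have b_lim: "(\<lambda>N. b N m) \<longlonglongrightarrow> inverse E" for m
  proof -
    have "filterlim (\<lambda>N. nat (int N + m)) at_top sequentially"
         "filterlim (\<lambda>N. nat (int N - m)) at_top sequentially"
         "filterlim (\<lambda>N. 2 * N :: nat) at_top sequentially"
      by real_asymp+
    then have "(\<lambda>N. qfac q (2 * N) * inverse (qfac q (nat (int N + m))) * inverse (qfac q (nat (int N - m))))
        \<longlonglongrightarrow> E * inverse E * inverse E"
      by (intro tendsto_mult filterlim_compose[OF lim(1)] filterlim_compose[OF lim(2)])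
    moreover have "\<forall>\<^sub>F N in sequentially. qfac q (2 * N) * inverse (qfac q (nat (int N + m)))
        * inverse (qfac q (nat (int N - m))) = b N m"
      using eventually_ge_at_top[of "nat \<bar>m\<bar>"] by eventually_elim (subst b_eq, auto)
    ultimately show ?thesis
      using E by (auto intro: Lim_transform_eventually)
  qed
  have t_summable: "(\<lambda>m. norm (t m)) summable_on UNIV"
    using theta_abs_summable[OF q, of "- x"] x by (simp add: t_def)
  \<comment> \<open>The sums converge uniformly in \<open>N\<close>, majorized by a multiple of the
    theta series; this permits swapping the two limits.\<close>
  have ulim: "uniform_limit UNIV (\<lambda>X N. \<Sum>m\<in>X. b N m * t m) (\<lambda>N. \<Sum>\<^sub>\<infinity>m. b N m * t m)
      (finite_subsets_at_top UNIV)"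
  proof (rule Weierstrass_m_test_general)
    show "norm (b N m * t m) \<le> B * B' * B' * norm (t m)" for m N
      unfolding norm_mult by (intro mult_right_mono b_bound) auto
    show "(\<lambda>m. B * B' * B' * norm (t m)) summable_on UNIV"
      by (intro summable_on_cmult_right t_summable)
  qed
  have "(\<lambda>N. \<Sum>\<^sub>\<infinity>m. b N m * t m) \<longlonglongrightarrow> inverse E * theta q x"
  proof (rule swap_uniform_limit'[OF _ _ ulim])
    show "\<forall>\<^sub>F X in finite_subsets_at_top UNIV. ((\<lambda>N. \<Sum>m\<in>X. b N m * t m) \<longlongrightarrow> (\<Sum>m\<in>X. inverse E * t m)) sequentially"
      by (intro always_eventually allI tendsto_intros b_lim)
    have "(t has_sum theta q x) UNIV"
      unfolding t_def by (rule theta_has_sum[OF q x])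
    then have "((\<lambda>m. inverse E * t m) has_sum (inverse E * theta q x)) UNIV"
      by (rule has_sum_cmult_right)
    then show "((\<lambda>X. \<Sum>m\<in>X. inverse E * t m) \<longlongrightarrow> inverse E * theta q x) (finite_subsets_at_top UNIV)"
      by (simp add: has_sum_def)
  qed auto
  moreover have "(\<Sum>\<^sub>\<infinity>m. b N m * t m) = (\<Prod>n<N. 1 - x * q ^ n) * (\<Prod>n<N. 1 - q / x * q ^ n)" for N
  proof -
    have "(\<Sum>\<^sub>\<infinity>m. b N m * t m) = (\<Sum>\<^sub>\<infinity>m\<in>{- int N..int N}. b N m * t m)"
      by (rule infsum_cong_neutral) (auto simp: b_def)
    also have "\<dots> = (\<Sum>m\<in>{- int N..int N}. b N m * t m)"
      by simp
    also have "\<dots> = (\<Prod>n<N. 1 - x * q ^ n) * (\<Prod>n<N. 1 - q / x * q ^ n)"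
      using q x by (subst finite_triple_product) (auto simp: b_def t_def)
    finally show ?thesis .
  qed
  moreover have "(\<lambda>N. (\<Prod>n<N. 1 - x * q ^ n) * (\<Prod>n<N. 1 - q / x * q ^ n))
      \<longlonglongrightarrow> qpoch q x * qpoch q (q / x)"
    by (intro tendsto_mult qpoch_LIMSEQ q)
  ultimately have "inverse E * theta q x = qpoch q x * qpoch q (q / x)"
    using LIMSEQ_unique by simp
  then show ?thesis
    using E by (simp add: E_def field_simps)
qed

section \<open>Integer vectors\<close>

definition vecs :: "nat \<Rightarrow> (nat \<Rightarrow> int) set" where
  "vecs a = {..<a} \<rightarrow>\<^sub>E UNIV"

definition vsum :: "nat \<Rightarrow> (nat \<Rightarrow> int) \<Rightarrow> int" where
  "vsum a n = (\<Sum>j<a. n j)"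

text \<open>A version of the exponent that is integral without the zero-sum condition: \<open>n \<cdot> n\<close> is
  replaced by \<open>n \<cdot> n - n \<cdot> 1\<close>.\<close>

definition tri_exponent :: "nat \<Rightarrow> (nat \<Rightarrow> int) \<Rightarrow> int" where
  "tri_exponent a n = (\<Sum>j<a. int a * tri (n j) + int j * n j)"

lemma zero_sum_vecs_eq: "zero_sum_vecs a = {n \<in> vecs a. vsum a n = 0}"
  by (simp add: zero_sum_vecs_def vecs_def vsum_def)

lemma q_exponent_eq:
  assumes "vsum a n = 0"
  shows "q_exponent a n = tri_exponent a n"
proof -
  have "2 * (\<Sum>j<a. tri (n j)) = (\<Sum>j<a. n j * n j) - vsum a n"
    by (simp add: sum_distrib_left two_tri vsum_def algebra_simps sum_subtractf)
  then have "int a * (\<Sum>j<a. n j * n j) = 2 * (int a * (\<Sum>j<a. tri (n j)))"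
    using assms by simp
  then have "(int a * (\<Sum>j<a. n j * n j)) div 2 = int a * (\<Sum>j<a. tri (n j))"
    by linarith
  then show ?thesis
    unfolding q_exponent_def tri_exponent_def by (simp only: sum.distrib sum_distrib_left)
qed

text \<open>In terms of the numbers \<open>a * n j + j\<close>, which form a complete residue system
  modulo \<open>a\<close>, the next two maps add 1 to all of them, respectively \<open>a\<close> to one of them.\<close>

definition cshift :: "nat \<Rightarrow> (nat \<Rightarrow> int) \<Rightarrow> nat \<Rightarrow> int" where
  "cshift a n = (\<lambda>j\<in>{..<a}. if j = 0 then n (a - 1) + 1 else n (j - 1))"

definition incr :: "nat \<Rightarrow> (nat \<Rightarrow> int) \<Rightarrow> nat \<Rightarrow> int" where
  "incr j n = n(j := n j + 1)"

definition cshift_inv :: "nat \<Rightarrow> (nat \<Rightarrow> int) \<Rightarrow> nat \<Rightarrow> int" where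
  "cshift_inv a n = (\<lambda>j\<in>{..<a}. if j = a - 1 then n 0 - 1 else n (Suc j))"

definition decr :: "nat \<Rightarrow> (nat \<Rightarrow> int) \<Rightarrow> nat \<Rightarrow> int" where
  "decr j n = n(j := n j - 1)"

lemma cshift_in_vecs [simp]: "cshift a n \<in> vecs a"
  and cshift_inv_in_vecs [simp]: "cshift_inv a n \<in> vecs a"
  by (simp_all add: cshift_def cshift_inv_def vecs_def)

lemma incr_in_vecs: "n \<in> vecs a \<Longrightarrow> j < a \<Longrightarrow> incr j n \<in> vecs a"
  and decr_in_vecs: "n \<in> vecs a \<Longrightarrow> j < a \<Longrightarrow> decr j n \<in> vecs a"
  by (auto simp: incr_def decr_def vecs_def PiE_def extensional_def)

lemma incr_decr [simp]: "incr j (decr j n) = n"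
  and decr_incr [simp]: "decr j (incr j n) = n"
  by (simp_all add: incr_def decr_def)

lemma sum_incr:
  fixes f :: "nat \<Rightarrow> int \<Rightarrow> int"
  assumes "j < a"
  shows "(\<Sum>i<a. f i (incr j n i)) = (\<Sum>i<a. f i (n i)) + (f j (n j + 1) - f j (n j))"
proof -
  have "(\<Sum>i<a. f i (incr j n i)) = f j (n j + 1) + (\<Sum>i\<in>{..<a} - {j}. f i (n i))"
    using assms by (subst sum.remove[of _ j]) (auto simp: incr_def)
  also have "(\<Sum>i\<in>{..<a} - {j}. f i (n i)) = (\<Sum>i<a. f i (n i)) - f j (n j)"
    using assms by (subst sum.remove[of "{..<a}" j]) auto
  finally show ?thesis by simp
qed

lemma vsum_incr: "j < a \<Longrightarrow> vsum a (incr j n) = vsum a n + 1"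
  using sum_incr[of j a "\<lambda>_ k. k" n] by (simp add: vsum_def)

text \<open>The gain is exactly the exponent that \<open>z\<close> carries at position
  \<open>j\<close> in the left-hand side; this links powers of \<open>q\<close> to powers of
  \<open>z\<close>.\<close>

lemma tri_exponent_incr:
  "j < a \<Longrightarrow> tri_exponent a (incr j n) = tri_exponent a n + (int a * n j + int j)"
  using sum_incr[of j a "\<lambda>j k. int a * tri k + int j * k" n] unfolding tri_plus_1
  by (simp add: tri_exponent_def algebra_simps)

lemma vsum_decr: "j < a \<Longrightarrow> vsum a (decr j n) = vsum a n - 1"
  using vsum_incr[of j a "decr j n"] by simp

context
  fixes a :: nat
  assumes a: "a > 0"
begin

lemma cshift_cshift_inv: "n \<in> vecs a \<Longrightarrow> cshift a (cshift_inv a n) = n"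
  and cshift_inv_cshift: "n \<in> vecs a \<Longrightarrow> cshift_inv a (cshift a n) = n"
  using a by (auto simp: cshift_def cshift_inv_def vecs_def PiE_def extensional_def fun_eq_iff)

lemma sum_cshift:
  "(\<Sum>j<a. f j (cshift a n j)) = f 0 (n (a - 1) + 1) + (\<Sum>j<a - 1. f (Suc j) (n j))"
proof -
  obtain b where b: "a = Suc b" using a by (cases a) auto
  show ?thesis
    unfolding b sum.lessThan_Suc_shift by (simp add: cshift_def)
qed

lemma vsum_cshift: "vsum a (cshift a n) = vsum a n + 1"
proof -
  obtain b where b: "a = Suc b" using a by (cases a) auto
  show ?thesis
    using sum_cshift[of "\<lambda>_ k. k" n] by (simp add: vsum_def b)
qed

text \<open>Moving up one place adds \<open>n j\<close> for each \<open>j < a - 1\<close>. The entry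
  that wraps around gains \<open>a * n (a - 1)\<close> from \<open>tri\<close> and loses
  \<open>(a - 1) * n (a - 1)\<close>, a net \<open>n (a - 1)\<close> again.\<close>

lemma tri_exponent_cshift: "tri_exponent a (cshift a n) = tri_exponent a n + vsum a n"
proof -
  obtain b where b: "a = Suc b" using a by (cases a) auto
  show ?thesis
    using sum_cshift[of "\<lambda>j k. int a * tri k + int j * k" n] unfolding tri_plus_1
    by (simp add: tri_exponent_def vsum_def b algebra_simps sum.distrib)
qed

lemma vsum_cshift_inv: "n \<in> vecs a \<Longrightarrow> vsum a (cshift_inv a n) = vsum a n - 1"
  using vsum_cshift[of "cshift_inv a n"] by (simp add: cshift_cshift_inv)

lemma tri_exponent_cshift_inv:
  "n \<in> vecs a \<Longrightarrow> tri_exponent a (cshift_inv a n) = tri_exponent a n - vsum a n + 1"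
  using tri_exponent_cshift[of "cshift_inv a n"] by (simp add: cshift_cshift_inv vsum_cshift_inv)

end

section \<open>Sums over vectors, two-sided recurrences, the geometric polynomial\<close>

lemma power_powi: "(x ^ k) powi m = (x :: 'a :: field) powi (int k * m)"
  by (metis power_int_mult power_int_of_nat)

lemma prod_powi_sum:
  fixes x :: "'a :: field"
  assumes "x \<noteq> 0" "finite A"
  shows "(\<Prod>i\<in>A. x powi f i) = x powi (\<Sum>i\<in>A. f i)"
  using assms(2) by (induction rule: finite_induct) (auto simp: power_int_add assms(1))

lemma vecs_prod_abs_summable:
  fixes f :: "nat \<Rightarrow> int \<Rightarrow> complex"
  assumes "\<And>j. j < a \<Longrightarrow> (\<lambda>m. norm (f j m)) summable_on UNIV"
  shows "(\<lambda>n. norm (\<Prod>j<a. f j (n j))) summable_on vecs a"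
proof -
  have "Infinite_Set_Sum.abs_summable_on (\<lambda>n. \<Prod>j<a. f j (n j)) (vecs a)"
    unfolding vecs_def
    by (intro abs_summable_on_prod_PiE) (use assms in \<open>auto simp flip: abs_summable_equivalent\<close>)
  then show ?thesis
    by (simp flip: abs_summable_equivalent)
qed

text \<open>Nonzero multipliers let the recurrence run in both directions, so it fixes a sequence up
  to its value at 0. Applied to \<open>level_sum\<close> and \<open>theta_coeff\<close>.\<close>

lemma int_recurrence_unique:
  fixes u v s :: "int \<Rightarrow> 'a :: field"
  assumes "\<And>m. u (m + 1) = s m * u m" "\<And>m. v (m + 1) = s m * v m" "\<And>m. s m \<noteq> 0"
    and "u 0 = c * v 0"
  shows "u m = c * v m"
proof (induction m rule: int_induct[of _ 0])
  case base
  show ?case by fact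
next
  case (step1 m)
  then show ?case
    by (simp only: assms(1,2) mult.left_commute)
next
  case (step2 m)
  have "s (m - 1) * u (m - 1) = c * (s (m - 1) * v (m - 1))"
    using step2(2) assms(1)[of "m - 1"] assms(2)[of "m - 1"] unfolding diff_add_cancel by metis
  then have "s (m - 1) * u (m - 1) = s (m - 1) * (c * v (m - 1))"
    by (simp only: mult.left_commute)
  then have "u (m - 1) = c * v (m - 1)"
    using assms(3)[of "m - 1"] by (metis mult_left_cancel)
  then show ?case .
qed

text \<open>The quotient of \<open>1 - w ^ a\<close> by \<open>1 - w\<close>, extended over
  \<open>w = 1\<close>.\<close>

definition geom_poly :: "nat \<Rightarrow> complex poly" where
  "geom_poly a = (\<Sum>j<a. monom 1 j)"

lemma poly_geom_poly: "poly (geom_poly a) w = (\<Sum>j<a. w ^ j)"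
  by (simp add: geom_poly_def poly_sum poly_monom)

lemma one_minus_mult_geom_poly: "(1 - w) * poly (geom_poly a) w = 1 - w ^ a"
  unfolding poly_geom_poly by (rule one_diff_power_eq[symmetric])

section \<open>The product of theta functions along a geometric progression\<close>

context
  fixes q :: complex and a :: nat
  assumes q: "0 < norm q" "norm q < 1" and a: "a > 0"
begin


lemma q_nz: "q \<noteq> 0"
  using q by auto

lemma norm_q_power: "0 < norm (q ^ a)" "norm (q ^ a) < 1"
  using q a by (simp_all add: norm_power power_less_one_iff)

text \<open>Factor \<open>j\<close> is a term of \<open>theta (q ^ a)\<close> at
  \<open>- y j * q ^ j\<close>. Free \<open>y j\<close> serve constant arguments as well as a
  \<open>z ^ a\<close> in a single position.\<close>

lemma weight_eq_prod:
  assumes "\<And>j. j < a \<Longrightarrow> y j \<noteq> 0"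
  shows "(\<Prod>j<a. (y j * q ^ j) powi n j * (q ^ a) powi tri (n j))
    = (\<Prod>j<a. y j powi n j) * q powi tri_exponent a n"
proof -
  have "(\<Prod>j<a. (y j * q ^ j) powi n j * (q ^ a) powi tri (n j))
      = (\<Prod>j<a. y j powi n j * q powi (int a * tri (n j) + int j * n j))"
    by (intro prod.cong refl)
      (simp only: power_int_mult_distrib power_powi power_int_add[OF disjI1[OF q_nz]] mult_ac)
  also have "\<dots> = (\<Prod>j<a. y j powi n j) * q powi tri_exponent a n"
    unfolding tri_exponent_def by (simp only: prod.distrib prod_powi_sum[OF q_nz finite_lessThan])
  finally show ?thesis .
qed

lemma weight_abs_summable:
  assumes "\<And>j. j < a \<Longrightarrow> y j \<noteq> 0"
  shows "(\<lambda>n. norm ((\<Prod>j<a. y j powi n j) * q powi tri_exponent a n)) summable_on vecs a"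
proof -
  have "(\<lambda>n. norm (\<Prod>j<a. (y j * q ^ j) powi n j * (q ^ a) powi tri (n j))) summable_on vecs a"
    by (intro vecs_prod_abs_summable theta_abs_summable norm_q_power) (use assms q_nz in auto)
  then show ?thesis
    by (simp only: weight_eq_prod[OF assms])
qed

lemma prod_theta_has_sum:
  assumes x: "x \<noteq> 0"
  shows "((\<lambda>n. (- x) powi vsum a n * q powi tri_exponent a n) has_sum
           (\<Prod>j<a. theta (q ^ a) (x * q ^ j))) (vecs a)"
proof -
  have w: "(\<Prod>j<a. (- x * q ^ j) powi n j * (q ^ a) powi tri (n j))
      = (- x) powi vsum a n * q powi tri_exponent a n" for n
    using weight_eq_prod[of "\<lambda>_. - x" n] x by (simp add: vsum_def prod_powi_sum)
  have "infsum (\<lambda>n. \<Prod>j<a. (- x * q ^ j) powi n j * (q ^ a) powi tri (n j)) (PiE {..<a} (\<lambda>_. UNIV))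
      = (\<Prod>j<a. \<Sum>\<^sub>\<infinity>m. (- x * q ^ j) powi m * (q ^ a) powi tri m)"
    by (intro infsum_prod_PiE_abs theta_abs_summable norm_q_power) (use x q_nz in auto)
  also have "\<dots> = (\<Prod>j<a. theta (q ^ a) (x * q ^ j))"
    by (simp add: theta_def)
  finally have "(\<Sum>\<^sub>\<infinity>n\<in>vecs a. (- x) powi vsum a n * q powi tri_exponent a n)
      = (\<Prod>j<a. theta (q ^ a) (x * q ^ j))"
    unfolding w vecs_def .
  moreover have "(\<lambda>n. (- x) powi vsum a n * q powi tri_exponent a n) summable_on vecs a"
    using abs_summable_summable[OF weight_abs_summable[of "\<lambda>_. - x"]] x
    by (simp add: vsum_def prod_powi_sum)
  ultimately show ?thesis
    by (simp add: has_sum_iff)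
qed

lemma norm_q_power_less_1: "0 < k \<Longrightarrow> norm (q ^ k) < 1"
  using q by (simp add: norm_power power_less_one_iff)

text \<open>The coefficient of \<open>(- x) powi m\<close> in the product of the
  \<open>theta (q ^ a) (x * q ^ j)\<close>.\<close>

definition level_sum :: "int \<Rightarrow> complex" where
  "level_sum m = (\<Sum>\<^sub>\<infinity>n\<in>{n \<in> vecs a. vsum a n = m}. q powi tri_exponent a n)"

text \<open>\<open>cshift\<close> maps the vectors of sum \<open>m\<close> bijectively onto those of
  sum \<open>m + 1\<close> and adds \<open>m\<close> to the exponent.\<close>

lemma level_sum_rec: "level_sum (m + 1) = q powi m * level_sum m"
proof -
  have "(\<Sum>\<^sub>\<infinity>n\<in>{n \<in> vecs a. vsum a n = m}. q powi m * q powi tri_exponent a n) = level_sum (m + 1)"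
    unfolding level_sum_def
    by (rule infsum_reindex_bij_witness[of _ "cshift_inv a" "cshift a"])
      (auto simp: cshift_in_vecs cshift_inv_in_vecs cshift_cshift_inv[OF a] cshift_inv_cshift[OF a] vsum_cshift[OF a] vsum_cshift_inv[OF a]
        tri_exponent_cshift[OF a] power_int_add[OF disjI1[OF q_nz]])
  then show ?thesis
    by (simp add: infsum_cmult_right' level_sum_def)
qed

lemma level_sum_eq: "level_sum m = level_sum 0 * q powi tri m"
  by (rule int_recurrence_unique[of level_sum "\<lambda>m. q powi m" "\<lambda>m. q powi tri m" "level_sum 0" m])
    (simp_all add: level_sum_rec tri_plus_1 power_int_add q_nz)

text \<open>Grouping the expanded product by coordinate sum gives the coefficients
  \<open>level_sum m\<close>, which by \<open>level_sum_eq\<close> are proportional to the theta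
  coefficients \<open>q powi tri m\<close>.\<close>

lemma prod_theta:
  assumes x: "x \<noteq> 0"
  shows "(\<Prod>j<a. theta (q ^ a) (x * q ^ j)) = level_sum 0 * theta q x"
proof -
  define V where "V m = {n \<in> vecs a. vsum a n = m}" for m
  have 1: "((\<lambda>(m, n). (- x) powi m * q powi tri_exponent a n) has_sum
      (\<Prod>j<a. theta (q ^ a) (x * q ^ j))) (Sigma UNIV V)"
    using prod_theta_has_sum[OF x]
    by (subst has_sum_reindex_bij_witness[of _ "\<lambda>n. (vsum a n, n)" snd "vecs a"]) (auto simp: V_def)
  have "((\<lambda>m. (- x) powi m * level_sum m) has_sum (\<Prod>j<a. theta (q ^ a) (x * q ^ j))) UNIV"
  proof (rule has_sum_SigmaD[OF 1], unfold prod.case)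
    fix m :: int
    have "(\<lambda>n. q powi tri_exponent a n) summable_on vecs a"
      using abs_summable_summable[OF weight_abs_summable[of "\<lambda>_. 1"]] by simp
    then have "(\<lambda>n. q powi tri_exponent a n) summable_on V m"
      by (rule summable_on_subset) (auto simp: V_def)
    then show "((\<lambda>n. (- x) powi m * q powi tri_exponent a n) has_sum (- x) powi m * level_sum m) (V m)"
      unfolding level_sum_def V_def by (intro has_sum_cmult_right has_sum_infsum)
  qed
  moreover have "((\<lambda>m. (- x) powi m * level_sum m) has_sum (level_sum 0 * theta q x)) UNIV"
    using has_sum_cmult_right[OF theta_has_sum[OF q x], of "level_sum 0"]
    by (simp add: level_sum_eq[symmetric] mult.left_commute)
  ultimately show ?thesis by (rule has_sum_unique)
qed

text \<open>At \<open>x = - 1\<close> the triple product makes both sides of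
  \<open>prod_theta\<close> multiples of \<open>qpoch q (- 1) * qpoch q (- q)\<close>. This is
  nonzero, as no \<open>- (q ^ n)\<close> equals 1.\<close>

lemma level_sum_0: "level_sum 0 * euler_E q = euler_E (q ^ a) ^ a"
proof -
  have "level_sum 0 * theta q (-1) = (\<Prod>j<a. theta (q ^ a) (- 1 * q ^ j))"
    by (rule prod_theta[symmetric]) simp
  \<comment> \<open>With the index reversed to \<open>a - Suc j\<close>, the last factor too runs
    through consecutive powers of \<open>q\<close>, so \<open>qpoch_regroup\<close> applies to
    both.\<close>
  also have "\<dots> = (\<Prod>j<a. euler_E (q ^ a) *
      (qpoch (q ^ a) (- 1 * q ^ j) * qpoch (q ^ a) (- q * q ^ (a - Suc j))))"
  proof (rule prod.cong[OF refl])
    fix j assume "j \<in> {..<a}"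
    then have "q ^ a = q ^ j * (q * q ^ (a - Suc j))"
      by (simp flip: power_add power_Suc)
    then have "q ^ a / (- 1 * q ^ j) = - q * q ^ (a - Suc j)"
      using q_nz by (simp add: field_simps)
    then show "theta (q ^ a) (- 1 * q ^ j) = euler_E (q ^ a) *
      (qpoch (q ^ a) (- 1 * q ^ j) * qpoch (q ^ a) (- q * q ^ (a - Suc j)))"
      using jacobi_triple_product[OF norm_q_power, of "- 1 * q ^ j"] q_nz by simp
  qed
  also have "\<dots> = euler_E (q ^ a) ^ a * ((\<Prod>j<a. qpoch (q ^ a) (- 1 * q ^ j)) * (\<Prod>j<a. qpoch (q ^ a) (- q * q ^ j)))"
    by (simp only: prod.distrib prod.nat_diff_reindex[of "\<lambda>j. qpoch (q ^ a) (- q * q ^ j)"]) simp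
  also have "\<dots> = euler_E (q ^ a) ^ a * (qpoch q (- 1) * qpoch q (- q))"
    unfolding qpoch_regroup[OF q(2) a] ..
  finally have "(level_sum 0 * euler_E q) * (qpoch q (- 1) * qpoch q (- q))
      = euler_E (q ^ a) ^ a * (qpoch q (- 1) * qpoch q (- q))"
    using jacobi_triple_product[OF q, of "- 1"] by (simp add: mult_ac)
  moreover have "- 1 * q ^ n \<noteq> 1" for n
  proof
    assume *: "- 1 * q ^ n = 1"
    then have "norm (q ^ n) = 1"
      by (metis mult_minus1 norm_minus_cancel norm_one)
    then have "n = 0"
      using norm_q_power_less_1[of n] by auto
    with * show False by simp
  qed
  moreover have "- q * q ^ n \<noteq> 1" for n
  proof
    assume "- q * q ^ n = 1"
    then have "norm (- q * q ^ n) = 1"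
      by simp
    with norm_q_power_less_1[of "Suc n"] show False
      by (simp add: norm_mult)
  qed
  ultimately show ?thesis
    by (simp add: qpoch_eq_0_iff[OF q(2)])
qed

section \<open>The left-hand side\<close>

text \<open>The left-hand side is flattened to one sum over pairs of a position and a vector,
  because the rotation below changes both.\<close>

definition zexp :: "nat \<times> (nat \<Rightarrow> int) \<Rightarrow> int" where
  "zexp = (\<lambda>(j, n). int a * n j + int j)"

definition qweight :: "nat \<times> (nat \<Rightarrow> int) \<Rightarrow> complex" where
  "qweight = (\<lambda>(j, n). q powi tri_exponent a n)"

definition index_set :: "(nat \<times> (nat \<Rightarrow> int)) set" where
  "index_set = {..<a} \<times> zero_sum_vecs a"

definition lhs :: "complex \<Rightarrow> complex" where
  "lhs z = (\<Sum>\<^sub>\<infinity>i\<in>index_set. qweight i * z powi zexp i)"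

lemma lhs_abs_summable:
  assumes z: "z \<noteq> 0"
  shows "(\<lambda>i. norm (qweight i * z powi zexp i)) summable_on index_set"
  unfolding index_set_def
proof (subst Infinite_Sum.abs_summable_on_Sigma_iff, intro conjI ballI)
  fix j assume "j \<in> {..<a}"
  \<comment> \<open>Only position \<open>j\<close> carries \<open>z ^ a\<close>, which produces
    \<open>z powi (int a * n j)\<close>; the remaining \<open>z ^ j\<close> is constant.\<close>
  define y where "y = (\<lambda>i. if i = j then z ^ a else 1)"
  have "(\<lambda>n. norm ((\<Prod>i<a. y i powi n i) * q powi tri_exponent a n)) summable_on vecs a"
    by (rule weight_abs_summable) (use z in \<open>auto simp: y_def\<close>)
  moreover have "(\<Prod>i<a. y i powi n i) = z powi (int a * n j)" for n
  proof -
    have "(\<Prod>i<a. y i powi n i) = (\<Prod>i<a. if i = j then z powi (int a * n j) else 1)"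
      by (intro prod.cong) (auto simp: y_def power_powi)
    then show ?thesis
      using \<open>j \<in> {..<a}\<close> by simp
  qed
  ultimately have "(\<lambda>n. norm (z ^ j) * norm (z powi (int a * n j) * q powi tri_exponent a n)) summable_on vecs a"
    by (intro summable_on_cmult_right) simp
  then have "(\<lambda>n. norm (qweight (j, n) * z powi zexp (j, n))) summable_on vecs a"
    using z by (simp add: qweight_def zexp_def power_int_add norm_mult mult_ac)
  then show "(\<lambda>n. norm (qweight (j, n) * z powi zexp (j, n))) summable_on zero_sum_vecs a"
    by (rule summable_on_subset) (auto simp: zero_sum_vecs_eq)
qed simp

lemma lhs_has_sum:
  assumes "z \<noteq> 0"
  shows "((\<lambda>i. qweight i * z powi zexp i) has_sum lhs z) index_set"
  unfolding lhs_def by (rule has_sum_infsum[OF abs_summable_summable[OF lhs_abs_summable[OF assms]]])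

lemma lhs_has_sum':
  assumes z: "z \<noteq> 0"
  shows "((\<lambda>n. q powi tri_exponent a n * (\<Sum>j<a. z powi (int a * n j + int j))) has_sum lhs z)
    (zero_sum_vecs a)"
proof -
  have "((\<lambda>(n, j). q powi tri_exponent a n * z powi (int a * n j + int j)) has_sum lhs z) (zero_sum_vecs a \<times> {..<a})"
    using lhs_has_sum[OF z] unfolding index_set_def
    by (subst (asm) has_sum_swap) (simp add: qweight_def zexp_def case_prod_unfold)
  then show ?thesis
    by (rule has_sum_SigmaD) (auto intro!: has_sum_finiteI simp: sum_distrib_left)
qed

lemma isCont_lhs:
  assumes z: "z \<noteq> 0"
  shows "isCont lhs z"
proof -
  \<comment> \<open>This places \<open>z\<close> inside the open annulus with radii
    \<open>1 / R\<close> and \<open>R\<close>.\<close>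
  define R where "R = norm z + 1 / norm z + 1"
  define Y where "Y = {w :: complex. 1 / R < norm w \<and> norm w < R}"
  have R: "R > 1" "norm z < R" "1 / norm z < R"
    using z by (auto simp: R_def add_pos_pos)
  have "open Y"
    unfolding Y_def by (intro open_Collect_conj open_Collect_less continuous_intros)
  have "z \<in> Y"
    using R z by (auto simp: Y_def field_simps)
  \<comment> \<open>A power of \<open>norm w\<close> is bounded by that of \<open>R\<close> or of
    \<open>1 / R\<close> according to the sign of the exponent; the sum covers both cases.\<close>
  let ?M = "\<lambda>i. norm (qweight i * of_real R powi zexp i) + norm (qweight i * of_real (1 / R) powi zexp i)"
  have "uniform_limit Y (\<lambda>X w. \<Sum>i\<in>X. qweight i * w powi zexp i) lhs (finite_subsets_at_top index_set)"
    unfolding lhs_def[abs_def]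
  proof (rule Weierstrass_m_test_general)
    show "?M summable_on index_set"
      by (intro summable_on_add lhs_abs_summable) (use R in auto)
    fix i w assume "w \<in> Y"
    moreover from this have "norm w > 0"
      using R by (auto simp: Y_def intro: less_trans[of 0 "1 / R"])
    ultimately have w: "norm w < R" "1 / norm w < R" "norm w > 0"
      using R by (auto simp: Y_def field_simps)
    have "norm w powi p \<le> R powi p + (1 / R) powi p" for p
    proof (cases "p \<ge> 0")
      case True
      then have "norm w powi p \<le> R powi p"
        using w by (intro power_int_mono) auto
      moreover have "0 \<le> (1 / R) powi p"
        using R by (intro zero_le_power_int) auto
      ultimately show ?thesis by linarith
    next
      case False
      then have "(1 / norm w) powi (- p) \<le> R powi (- p)"
        using w by (intro power_int_mono) auto
      then have "norm w powi p \<le> (1 / R) powi p"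
        by (simp add: power_int_minus power_int_divide_distrib inverse_eq_divide)
      moreover have "0 \<le> R powi p"
        using R by (intro zero_le_power_int) auto
      ultimately show ?thesis by linarith
    qed
    from mult_left_mono[OF this norm_ge_zero[of "qweight i"]]
    show "norm (qweight i * w powi zexp i) \<le> ?M i"
      using R by (simp add: norm_mult norm_power_int norm_divide distrib_left)
  qed
  then have "continuous_on Y lhs"
    by (rule uniform_limit_theorem[rotated])
      (auto intro!: always_eventually continuous_intros simp: Y_def)
  with \<open>open Y\<close> \<open>z \<in> Y\<close> show ?thesis
    by (simp add: continuous_on_eq_continuous_at)
qed


text \<open>Here \<open>w powi (int a * n j)\<close> is 1, so for every vector the inner sum is the
  full geometric sum of a nontrivial root of unity.\<close>

lemma lhs_root_of_unity:
  assumes "w ^ a = 1" "w \<noteq> 1"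
  shows "lhs w = 0"
proof -
  have w: "w \<noteq> 0"
    using assms a by (auto simp: zero_power)
  have "(\<Sum>j<a. w powi (int a * n j + int j)) = 0" for n :: "nat \<Rightarrow> int"
  proof -
    have "w powi (int a * m) = 1" for m
      using assms(1) power_powi[of w a m] by simp
    then have "(\<Sum>j<a. w powi (int a * n j + int j)) = (\<Sum>j<a. w ^ j)"
      using w by (simp add: power_int_add)
    also have "\<dots> = 0"
      using assms by (simp add: geometric_sum)
    finally show ?thesis .
  qed
  with lhs_has_sum'[OF w] show ?thesis
    by (simp add: has_sum_0_simp has_sum_unique[of "\<lambda>_. 0"])
qed

section \<open>The coefficients of the product of \<open>lhs\<close> and
  \<open>theta q\<close>\<close>

definition signed_q :: "int \<Rightarrow> complex" where
  "signed_q m = (- 1) powi m * q powi tri m"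

lemma signed_q_Suc: "signed_q (m + 1) = - (q powi m) * signed_q m"
  by (simp add: signed_q_def tri_plus_1 power_int_add q_nz)

text \<open>The coefficient \<open>l k\<close> of the Cauchy product of \<open>lhs\<close> with
  \<open>theta q\<close>, whose own coefficients are the \<open>signed_q m\<close>.\<close>

definition theta_coeff :: "int \<Rightarrow> complex" where
  "theta_coeff k = (\<Sum>\<^sub>\<infinity>i\<in>index_set. qweight i * signed_q (k - zexp i))"

lemma theta_coeff_has_sum:
  assumes z: "z \<noteq> 0"
  shows "((\<lambda>k. z powi k * theta_coeff k) has_sum (lhs z * theta q z)) UNIV"
proof -
  let ?f = "\<lambda>i. qweight i * z powi zexp i" and ?g = "\<lambda>m. (- z) powi m * q powi tri m"
  have g_eq: "?g m = z powi m * signed_q m" for m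
    using power_int_mult_distrib[of "- 1" z m] by (simp add: signed_q_def)
  have g_abs: "(\<lambda>m. norm (?g m)) summable_on UNIV"
    by (rule theta_abs_summable) (use q z in auto)
  have "(\<lambda>(i, m). ?f i * ?g m) summable_on (index_set \<times> UNIV)"
  proof (rule abs_summable_summable, subst Infinite_Sum.abs_summable_on_Sigma_iff, intro conjI ballI)
    show "(\<lambda>m. norm (case (i, m) of (i, m) \<Rightarrow> ?f i * ?g m)) summable_on UNIV" for i
      unfolding prod.case norm_mult[of "?f i"] by (intro summable_on_cmult_right g_abs)
    have "(\<lambda>i. norm (?f i) * (\<Sum>\<^sub>\<infinity>m. norm (?g m))) summable_on index_set"
      by (intro summable_on_cmult_left lhs_abs_summable z)
    then have "(\<lambda>i. \<Sum>\<^sub>\<infinity>m. norm (case (i, m) of (i, m) \<Rightarrow> ?f i * ?g m)) summable_on index_set"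
      unfolding prod.case norm_mult[of "?f _"] infsum_cmult_right' .
    then show "(\<lambda>i. norm (\<Sum>\<^sub>\<infinity>m. norm (case (i, m) of (i, m) \<Rightarrow> ?f i * ?g m))) summable_on index_set"
      by (simp add: infsum_nonneg)
  qed
  moreover have "((\<lambda>m. (\<lambda>(i, m). ?f i * ?g m) (i, m)) has_sum ?f i * theta q z) UNIV" for i
    unfolding prod.case by (intro has_sum_cmult_right theta_has_sum[OF q] z)
  moreover have "((\<lambda>i. ?f i * theta q z) has_sum lhs z * theta q z) index_set"
    by (intro has_sum_cmult_left lhs_has_sum z)
  ultimately have "((\<lambda>(i, m). ?f i * ?g m) has_sum lhs z * theta q z) (index_set \<times> UNIV)"
    by (intro has_sum_SigmaI)
  \<comment> \<open>Reindexing by the total exponent \<open>k = m + zexp i\<close> collects the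
    double series by powers of \<open>z\<close>.\<close>
  then have 1: "((\<lambda>(k, i). z powi k * (qweight i * signed_q (k - zexp i))) has_sum lhs z * theta q z) (UNIV \<times> index_set)"
    by (subst has_sum_reindex_bij_witness[of _ "\<lambda>(i, m). (m + zexp i, i)" "\<lambda>(k, i). (i, k - zexp i)"])
      (use z in \<open>auto simp: g_eq power_int_diff\<close>)
  show ?thesis
  proof (rule has_sum_SigmaD[OF 1], unfold prod.case)
    fix k :: int
    have "(\<lambda>i. z powi k * (qweight i * signed_q (k - zexp i))) summable_on index_set"
      using summable_on_SigmaD1[OF has_sum_imp_summable[OF 1], of k] by simp
    then have "(\<lambda>i. qweight i * signed_q (k - zexp i)) summable_on index_set"
      using z by (subst (asm) summable_on_cmult_right') auto
    then show "((\<lambda>i. z powi k * (qweight i * signed_q (k - zexp i))) has_sum z powi k * theta_coeff k) index_set"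
      unfolding theta_coeff_def by (intro has_sum_cmult_right has_sum_infsum)
  qed
qed

text \<open>In terms of the numbers \<open>a * n j + j\<close>: add \<open>a\<close> to the marked
  one, then subtract 1 from all. The sum of the vector stays 0, and the mark follows its number to
  the preceding residue.\<close>

definition rotate_down :: "nat \<times> (nat \<Rightarrow> int) \<Rightarrow> nat \<times> (nat \<Rightarrow> int)" where
  "rotate_down = (\<lambda>(j, n). (if j = 0 then a - 1 else j - 1, cshift_inv a (incr j n)))"

definition rotate_up :: "nat \<times> (nat \<Rightarrow> int) \<Rightarrow> nat \<times> (nat \<Rightarrow> int)" where
  "rotate_up = (\<lambda>(j, n). let j' = if j = a - 1 then 0 else j + 1 in (j', decr j' (cshift a n)))"

lemma rotate_down_in_index_set: "i \<in> index_set \<Longrightarrow> rotate_down i \<in> index_set"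
  and rotate_up_in_index_set: "i \<in> index_set \<Longrightarrow> rotate_up i \<in> index_set"
  using a by (auto simp: index_set_def rotate_down_def rotate_up_def Let_def zero_sum_vecs_eq cshift_in_vecs
    cshift_inv_in_vecs incr_in_vecs decr_in_vecs vsum_cshift[OF a] vsum_cshift_inv[OF a]
    vsum_incr vsum_decr)

lemma rotate_up_down: "i \<in> index_set \<Longrightarrow> rotate_up (rotate_down i) = i"
  and rotate_down_up: "i \<in> index_set \<Longrightarrow> rotate_down (rotate_up i) = i"
  using a by (auto simp: index_set_def rotate_down_def rotate_up_def Let_def zero_sum_vecs_eq cshift_in_vecs
    incr_in_vecs cshift_cshift_inv[OF a] cshift_inv_cshift[OF a] incr_decr decr_incr)

lemma zexp_rotate_down: "i \<in> index_set \<Longrightarrow> zexp (rotate_down i) = zexp i + int a - 1"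
  using a by (auto simp: index_set_def rotate_down_def zexp_def cshift_inv_def incr_def of_nat_diff algebra_simps)

text \<open>\<open>incr\<close> adds \<open>zexp i\<close> to the exponent and makes the coordinate
  sum 1; at that sum \<open>cshift_inv\<close> leaves the exponent alone.\<close>

lemma qweight_rotate_down: "i \<in> index_set \<Longrightarrow> qweight (rotate_down i) = qweight i * q powi zexp i"
  by (auto simp: index_set_def rotate_down_def qweight_def zexp_def zero_sum_vecs_eq incr_in_vecs
    tri_exponent_cshift_inv[OF a] vsum_incr tri_exponent_incr power_int_add q_nz)

text \<open>Under \<open>rotate_down\<close> the weight gains \<open>q powi zexp i\<close>, while
  the argument of \<open>signed_q\<close> grows by 1 and contributes
  \<open>- (q powi (k - zexp i))\<close>. Their product \<open>- (q powi k)\<close> is the same for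
  all \<open>i\<close>.\<close>

lemma theta_coeff_rec: "theta_coeff (k + int a) = - (q powi k) * theta_coeff k"
proof -
  have "(\<Sum>\<^sub>\<infinity>i\<in>index_set. - (q powi k) * (qweight i * signed_q (k - zexp i))) = theta_coeff (k + int a)"
    unfolding theta_coeff_def
  proof (rule infsum_reindex_bij_witness[of _ rotate_up rotate_down])
    fix i assume i: "i \<in> index_set"
    have "k + int a - zexp (rotate_down i) = (k - zexp i) + 1"
      using zexp_rotate_down[OF i] by simp
    then have "signed_q (k + int a - zexp (rotate_down i)) = - (q powi (k - zexp i)) * signed_q (k - zexp i)"
      by (simp only: signed_q_Suc)
    moreover have "q powi k = q powi zexp i * q powi (k - zexp i)"
      by (simp add: q_nz flip: power_int_add)
    ultimately show "qweight (rotate_down i) * signed_q (k + int a - zexp (rotate_down i))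
        = - (q powi k) * (qweight i * signed_q (k - zexp i))"
      by (simp add: qweight_rotate_down[OF i])
  qed (simp_all add: rotate_down_in_index_set rotate_up_in_index_set rotate_up_down rotate_down_up)
  then show ?thesis
    unfolding theta_coeff_def infsum_cmult_right' by simp
qed

text \<open>Within a residue class modulo \<open>a\<close>, the recurrence is that of the terms of
  \<open>theta (q ^ a) (q ^ r)\<close>.\<close>

lemma theta_coeff_residue:
  "theta_coeff (int r + int a * m) = theta_coeff (int r) * ((- (q ^ r)) powi m * (q ^ a) powi tri m)"
proof (rule int_recurrence_unique[of "\<lambda>m. theta_coeff (int r + int a * m)" "\<lambda>m. - (q powi (int r + int a * m))"
    "\<lambda>m. (- (q ^ r)) powi m * (q ^ a) powi tri m" "theta_coeff (int r)" m])
  fix m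
  show "theta_coeff (int r + int a * (m + 1)) = - (q powi (int r + int a * m)) * theta_coeff (int r + int a * m)"
    using theta_coeff_rec[of "int r + int a * m"] by (simp add: algebra_simps)
  show "(- (q ^ r)) powi (m + 1) * (q ^ a) powi tri (m + 1)
      = - (q powi (int r + int a * m)) * ((- (q ^ r)) powi m * (q ^ a) powi tri m)"
    using power_powi[of q a m]
    by (simp add: tri_plus_1 power_int_add q_nz)
qed (simp_all add: q_nz)

text \<open>Splitting the exponents as \<open>k = r + a * m\<close> makes each residue class a theta
  series in base \<open>q ^ a\<close>.\<close>

lemma lhs_theta_expansion:
  assumes z: "z \<noteq> 0"
  shows "lhs z * theta q z = (\<Sum>r<a. z ^ r * theta_coeff (int r) * theta (q ^ a) (z ^ a * q ^ r))"
proof -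
  have 1: "((\<lambda>(r, m). z powi (int r + int a * m) * theta_coeff (int r + int a * m)) has_sum lhs z * theta q z)
      ({..<a} \<times> UNIV)"
  proof -
    have "bij_betw (\<lambda>(r, m). int r + int a * m) ({..<a} \<times> UNIV) UNIV"
      by (rule bij_betwI[of _ _ _ "\<lambda>k. (nat (k mod int a), k div int a)"])
        (use a in \<open>auto simp: nat_less_iff\<close>)
    from has_sum_reindex_bij_betw[OF this, of "\<lambda>k. z powi k * theta_coeff k"] theta_coeff_has_sum[OF z] show ?thesis
      by (simp add: case_prod_unfold)
  qed
  have "((\<lambda>r. z ^ r * theta_coeff (int r) * theta (q ^ a) (z ^ a * q ^ r)) has_sum lhs z * theta q z) {..<a}"
  proof (rule has_sum_SigmaD[OF 1], unfold prod.case)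
    fix r
    have "z powi (int r + int a * m) * theta_coeff (int r + int a * m)
        = z ^ r * theta_coeff (int r) * ((- (z ^ a * q ^ r)) powi m * (q ^ a) powi tri m)" for m
      using power_int_mult_distrib[of "z ^ a" "- (q ^ r)" m]
      by (simp add: theta_coeff_residue power_int_add z power_powi)
    then show "((\<lambda>m. z powi (int r + int a * m) * theta_coeff (int r + int a * m))
        has_sum z ^ r * theta_coeff (int r) * theta (q ^ a) (z ^ a * q ^ r)) UNIV"
      using has_sum_cmult_right[OF theta_has_sum[OF norm_q_power, of "z ^ a * q ^ r"],
          of "z ^ r * theta_coeff (int r)"] z q_nz
      by simp
  qed
  then show ?thesis
    using has_sum_unique has_sum_finite[OF finite_lessThan] by blast
qed

section \<open>Vanishing of the coefficients outside residue 0\<close>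

lemma theta_1: "theta q 1 = 0"
  using jacobi_triple_product[OF q, of 1] by (auto simp: qpoch_eq_0_iff[OF q(2)] intro: exI[of _ 0])

text \<open>By the triple product, a zero would need \<open>q ^ (r + a * n) = 1\<close> or
  \<open>q ^ (a - r + a * n) = 1\<close>, but these exponents are positive.\<close>

lemma theta_q_power_nonzero:
  assumes "0 < r" "r < a"
  shows "theta (q ^ a) (q ^ r) \<noteq> 0"
proof -
  have nz: "qpoch (q ^ a) (q ^ s) \<noteq> 0" if "0 < s" for s
  proof -
    have "q ^ s * (q ^ a) ^ n \<noteq> 1" for n
      using norm_q_power_less_1[of "s + a * n"] that by (auto simp: power_add power_mult)
    then show ?thesis
      by (simp add: qpoch_eq_0_iff[OF norm_q_power(2)])
  qed
  have "q ^ a / q ^ r = q ^ (a - r)"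
    using assms q_nz by (simp add: power_diff)
  then show ?thesis
    using nz[of r] nz[of "a - r"] assms jacobi_triple_product[OF norm_q_power, of "q ^ r"]
      euler_E_nonzero[OF norm_q_power(2)] q_nz by simp
qed

text \<open>Both sides of \<open>lhs_theta_expansion\<close> vanish at all \<open>a\<close>-th roots of unity, which
  determine the polynomial in \<open>z\<close> that the right-hand side becomes there.\<close>

lemma theta_coeff_eq_0:
  assumes "0 < r" "r < a"
  shows "theta_coeff (int r) = 0"
proof -
  define c where "c r = theta_coeff (int r) * theta (q ^ a) (q ^ r)" for r
  define p where "p = (\<Sum>r<a. monom (c r) r)"
  have root: "poly p w = 0" if "w ^ a = 1" for w
  proof -
    have "w \<noteq> 0"
      using that a by (auto simp: zero_power)
    then have "poly p w = lhs w * theta q w"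
      unfolding lhs_theta_expansion[OF \<open>w \<noteq> 0\<close>] that
      by (simp add: p_def poly_sum poly_monom c_def mult_ac)
    also have "\<dots> = 0"
      using lhs_root_of_unity[OF that] theta_1 by (cases "w = 1") auto
    finally show ?thesis .
  qed
  have "p = 0"
  proof (rule ccontr)
    assume "p \<noteq> 0"
    \<comment> \<open>All \<open>a\<close> roots of unity are roots of \<open>p\<close>, more than
      its degree allows.\<close>
    have "card {w :: complex. w ^ a = 1} \<le> card {w. poly p w = 0}"
      using root poly_roots_finite[OF \<open>p \<noteq> 0\<close>] by (intro card_mono) auto
    also have "\<dots> \<le> degree p"
      using \<open>p \<noteq> 0\<close> by (rule card_poly_roots_bound)
    also have "degree p \<le> a - 1"
      unfolding p_def by (intro degree_sum_le) (auto intro: order_trans[OF degree_monom_le])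
    finally show False
      using a card_roots_unity_eq[of a] by simp
  qed
  moreover have "coeff p r = c r"
    using assms by (simp add: p_def coeff_sum coeff_monom sum.delta)
  ultimately show ?thesis
    using theta_q_power_nonzero[OF assms] by (simp add: c_def)
qed

lemma lhs_theta:
  assumes "z \<noteq> 0"
  shows "lhs z * theta q z = theta_coeff 0 * theta (q ^ a) (z ^ a)"
proof -
  have "lhs z * theta q z = (\<Sum>r<a. if r = 0 then theta_coeff 0 * theta (q ^ a) (z ^ a) else 0)"
    unfolding lhs_theta_expansion[OF assms] by (intro sum.cong) (auto simp: theta_coeff_eq_0)
  then show ?thesis
    using a by simp
qed

section \<open>The right-hand side\<close>

lemma poly_geom_poly_0: "poly (geom_poly a) 0 = 1"
  using one_minus_mult_geom_poly[of 0 a] a by (simp add: zero_power)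

text \<open>The infinite product on the right after cancelling, continuous at every nonzero
  \<open>z\<close>.\<close>

definition rhs_prod :: "complex \<Rightarrow> complex" where
  "rhs_prod z = poly_qprod (geom_poly a) q z * poly_qprod (geom_poly a) q (q / z)"

lemma isCont_rhs_prod:
  assumes "z \<noteq> 0"
  shows "isCont rhs_prod z"
  unfolding rhs_prod_def
  by (intro continuous_intros isCont_o2[OF _ isCont_poly_qprod] isCont_poly_qprod q poly_geom_poly_0 assms)

lemma remove_sings_quot_factor:
  assumes z: "z \<noteq> 0"
  shows "remove_sings (quot_factor a q n) z
    = poly (geom_poly a) (z * q ^ n) * poly (geom_poly a) (q / z * q ^ n)"
proof (rule remove_sings_eqI)
  let ?g = "\<lambda>w. poly (geom_poly a) (w * q ^ n) * poly (geom_poly a) (q / w * q ^ n)"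
  have "?g \<midarrow>z\<rightarrow> ?g z"
    using z by (intro tendsto_intros) auto
  moreover have "\<forall>\<^sub>F w in at z. ?g w = quot_factor a q n w"
  proof -
    \<comment> \<open>Away from \<open>w = 0\<close> these are the only zeros of the denominator, so
      cancelling is legitimate in a punctured neighbourhood of \<open>z\<close>.\<close>
    have "\<forall>\<^sub>F w in at z. w \<noteq> 0 \<and> w \<noteq> 1 / q ^ n \<and> w \<noteq> q ^ Suc n"
      by (intro eventually_conj eventually_neq_at_within)
    then show ?thesis
    proof eventually_elim
      case (elim w)
      have nz: "1 - w * q ^ n \<noteq> 0" "1 - q / w * q ^ n \<noteq> 0"
        using elim q_nz by (auto simp: field_simps)
      have "1 - w ^ a * q ^ (a * n) = 1 - (w * q ^ n) ^ a"
        by (simp add: power_mult_distrib mult.commute[of a] power_mult)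
      moreover have "w powi (- int a) * q ^ (a * (n + 1)) = (q / w * q ^ n) ^ a"
      proof -
        have "q ^ (a * (n + 1)) = (q * q ^ n) ^ a"
          by (metis mult.commute power_Suc power_mult Suc_eq_plus1)
        then show ?thesis
          by (simp add: power_int_minus power_mult_distrib power_divide field_simps)
      qed
      moreover have "inverse w * q ^ (n + 1) = q / w * q ^ n"
        by (simp add: divide_inverse)
      ultimately show ?case
        unfolding quot_factor_def using nz
        by (auto simp flip: one_minus_mult_geom_poly)
    qed
  qed
  ultimately show "quot_factor a q n \<midarrow>z\<rightarrow> ?g z"
    by (rule Lim_transform_eventually)
qed

lemma prodinf_remove_sings_quot_factor:
  assumes "z \<noteq> 0"
  shows "(\<Prod>n. remove_sings (quot_factor a q n) z) = rhs_prod z"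
  unfolding rhs_prod_def poly_qprod_def remove_sings_quot_factor[OF assms]
  by (intro prodinf_mult[symmetric] convergent_poly_qprod q poly_geom_poly_0)

text \<open>Factor by factor, \<open>1 - v ^ a\<close> is \<open>1 - v\<close> times the geometric
  polynomial at \<open>v = w * q ^ n\<close>.\<close>

lemma qpoch_power: "qpoch (q ^ a) (w ^ a) = qpoch q w * poly_qprod (geom_poly a) q w"
proof -
  have "(w * q ^ n) ^ a = w ^ a * (q ^ a) ^ n" for n
    by (simp add: power_mult_distrib mult.commute flip: power_mult)
  moreover have "poly ([:1, -1:] * geom_poly a) v = 1 - v ^ a" for v
    unfolding poly_mult using one_minus_mult_geom_poly[of v a] by simp
  ultimately have "qpoch (q ^ a) (w ^ a) = poly_qprod ([:1, -1:] * geom_poly a) q w"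
    by (simp only: poly_qprod_def) simp
  then show ?thesis
    using poly_qprod_mult[OF q(2), of "[:1, -1:]"] poly_geom_poly_0 by simp
qed

section \<open>Comparison of the two sides and determination of the constant\<close>

lemma lhs_eq_generic:
  assumes z: "z \<noteq> 0" and nz: "qpoch q z \<noteq> 0" "qpoch q (q / z) \<noteq> 0"
  shows "lhs z * euler_E q = theta_coeff 0 * euler_E (q ^ a) * rhs_prod z"
proof -
  have "lhs z * euler_E q * (qpoch q z * qpoch q (q / z))
      = theta_coeff 0 * euler_E (q ^ a) * (qpoch (q ^ a) (z ^ a) * qpoch (q ^ a) ((q / z) ^ a))"
    using lhs_theta[OF z] jacobi_triple_product[OF q z]
      jacobi_triple_product[OF norm_q_power, of "z ^ a"] z
    by (simp add: power_divide mult_ac)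
  also have "\<dots> = theta_coeff 0 * euler_E (q ^ a) * rhs_prod z * (qpoch q z * qpoch q (q / z))"
    by (simp add: qpoch_power rhs_prod_def mult_ac)
  finally show ?thesis
    using nz by simp
qed

text \<open>The exceptional points of \<open>lhs_eq_generic\<close> are countably many powers of
  \<open>q\<close>. By continuity a failure at \<open>z\<close> would persist on a whole ball, which
  is uncountable and so contains a generic point.\<close>

lemma lhs_eq:
  assumes z: "z \<noteq> 0"
  shows "lhs z * euler_E q = theta_coeff 0 * euler_E (q ^ a) * rhs_prod z"
proof (rule ccontr)
  assume neq: "\<not> ?thesis"
  define d where "d w = lhs w * euler_E q - theta_coeff 0 * euler_E (q ^ a) * rhs_prod w" for w
  have cont: "isCont d w" if "w \<noteq> 0" for w
    unfolding d_def[abs_def]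
    by (intro continuous_intros isCont_lhs[OF that] isCont_rhs_prod[OF that])
  define S where "S = - {0} \<inter> d -` (- {0})"
  have "open S"
    unfolding S_def
    by (intro continuous_open_preimage continuous_at_imp_continuous_on ballI cont) auto
  moreover have "z \<in> S"
    using z neq by (simp add: S_def d_def)
  ultimately obtain e where "e > 0" "ball z e \<subseteq> S"
    by (auto simp: open_contains_ball)
  moreover have "\<not> ball z e \<subseteq> range (\<lambda>n. 1 / q ^ n) \<union> range (\<lambda>n. q * q ^ n)"
    using uncountable_ball[OF \<open>e > 0\<close>, of z] countable_subset by (metis countable_Un countableI_type countable_image)
  ultimately obtain w where w: "w \<in> S" "w \<notin> range (\<lambda>n. 1 / q ^ n)" "w \<notin> range (\<lambda>n. q * q ^ n)"
    by blast
  then have "w \<noteq> 0" "d w \<noteq> 0"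
    by (auto simp: S_def)
  moreover have "qpoch q w \<noteq> 0"
    using w(2) q_nz by (auto simp: qpoch_eq_0_iff[OF q(2)] image_iff field_simps)
  moreover have "qpoch q (q / w) \<noteq> 0"
    using w(3) \<open>w \<noteq> 0\<close> by (auto simp: qpoch_eq_0_iff[OF q(2)] image_iff field_simps)
  ultimately show False
    using lhs_eq_generic[of w] by (simp add: d_def)
qed

text \<open>At \<open>z = 1\<close> the inner sum is \<open>a\<close> for every vector.\<close>

lemma lhs_1: "lhs 1 = of_nat a * level_sum 0"
proof -
  have "lhs 1 = (\<Sum>\<^sub>\<infinity>n\<in>zero_sum_vecs a. q powi tri_exponent a n * of_nat a)"
    using infsumI[OF lhs_has_sum'[of 1]] by simp
  then show ?thesis
    by (simp add: infsum_cmult_left' level_sum_def zero_sum_vecs_eq)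
qed

text \<open>Splitting off the first factor, which is \<open>a\<close>, reduces the value at 1 to
  that at \<open>q\<close>; the latter is \<open>euler_E (q ^ a) / euler_E q\<close> by
  \<open>qpoch_power\<close>.\<close>

lemma rhs_prod_1: "rhs_prod 1 * euler_E q ^ 2 = of_nat a * euler_E (q ^ a) ^ 2"
proof -
  let ?P = "poly_qprod (geom_poly a) q"
  have E: "euler_E (q ^ a) = euler_E q * ?P q"
    unfolding euler_E_eq_qpoch by (rule qpoch_power)
  have "?P 1 = of_nat a * ?P q"
  proof -
    have "poly (geom_poly a) (1 * q ^ 0) = of_nat a"
      by (simp add: poly_geom_poly)
    with prodinf_split_head[OF convergent_poly_qprod[OF q(2) poly_geom_poly_0, of 1]] a show ?thesis
      by (simp add: poly_qprod_def)
  qed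
  then show ?thesis
    by (simp add: rhs_prod_def E power2_eq_square)
qed

lemma lhs_eq_rhs_prod:
  assumes z: "z \<noteq> 0" and "a \<ge> 2"
  shows "lhs z = euler_E q * euler_E (q ^ a) ^ (a - 2) * rhs_prod z"
proof -
  define E A c K where "E = euler_E q" and "A = euler_E (q ^ a)" and "c = theta_coeff 0" and "K = level_sum 0"
  have nz: "E \<noteq> 0" "A \<noteq> 0" "of_nat a \<noteq> (0 :: complex)"
    using euler_E_nonzero[OF q(2)] euler_E_nonzero[OF norm_q_power(2)] a
    by (simp_all add: E_def A_def)
  have "A ^ a = A ^ (a - 2) * A ^ 2"
    using \<open>a \<ge> 2\<close> by (metis le_add_diff_inverse2 power_add)
  then have K: "K * E = A ^ (a - 2) * A ^ 2"
    using level_sum_0 by (simp add: K_def E_def A_def)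
  have P: "rhs_prod 1 * E ^ 2 = of_nat a * A ^ 2"
    using rhs_prod_1 by (simp add: E_def A_def)
  have "of_nat a * K * E = c * A * rhs_prod 1"
    using lhs_eq[of 1] by (simp add: lhs_1 E_def A_def c_def K_def)
  then have "of_nat a * (K * E) * E ^ 2 = c * A * (rhs_prod 1 * E ^ 2)"
    by (simp add: mult_ac)
  then have "(of_nat a * A ^ 2) * (A ^ (a - 2) * E ^ 2) = (of_nat a * A ^ 2) * (c * A)"
    unfolding K P by (simp add: mult_ac)
  \<comment> \<open>The unknown constant, obtained by evaluating both sides at
    \<open>z = 1\<close>.\<close>
  then have cA: "c * A = A ^ (a - 2) * E ^ 2"
    using nz by simp
  have "lhs z * E = c * A * rhs_prod z"
    using lhs_eq[OF z] by (simp add: E_def A_def c_def)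
  also have "\<dots> = (E * A ^ (a - 2) * rhs_prod z) * E"
    unfolding cA by (simp add: power2_eq_square mult_ac)
  finally show ?thesis
    using nz by (simp add: E_def A_def)
qed

end

theorem theorem1p2:
  fixes a :: nat and q z :: complex
  assumes "a \<ge> 2" and "0 < norm q" and "norm q < 1" and "z \<noteq> 0"
  shows "((\<lambda>n. q powi q_exponent a n * (\<Sum>j<a. z powi (int a * n j + int j)))
          has_sum
            (euler_E q * euler_E (q ^ a) ^ (a - 2)
              * (\<Prod>n. remove_sings (quot_factor a q n) z)))
         (zero_sum_vecs a)"
proof -
  have a: "a > 0"
    using assms(1) by simp
  have "((\<lambda>n. q powi tri_exponent a n * (\<Sum>j<a. z powi (int a * n j + int j))) has_sum lhs q a z)
      (zero_sum_vecs a)"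
    by (rule lhs_has_sum'[OF assms(2,3) a assms(4)])
  also have "?this \<longleftrightarrow> ((\<lambda>n. q powi q_exponent a n * (\<Sum>j<a. z powi (int a * n j + int j))) has_sum lhs q a z)
      (zero_sum_vecs a)"
    by (rule has_sum_cong) (simp add: zero_sum_vecs_eq q_exponent_eq)
  finally show ?thesis
    unfolding prodinf_remove_sings_quot_factor[OF assms(2,3) a assms(4)]
      lhs_eq_rhs_prod[OF assms(2,3) a assms(4,1)] .
qed

end
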